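(* Every non-reflexive M-embedded Banach space is almost square (ASQ).
   Context: All Banach spaces are real. $S_X$ and $B_X$ denote the unit sphere and closed unit ball of $X$. A Banach space $X$ is almost square (ASQ) if for every finite subset $(x_i)_{i=1}^N \subset S_X$ there exists a sequence $(y_n)\subset B_X$ such that $\|x_i\pm y_n\|\to 1$ for every $i=1,\ldots,N$ and $\|y_n\|\to 1$. A subspace $Y$ of a Banach space $Z$ is an M-ideal in $Z$ if there is a norm one projection $P$ on $Z^*$ whose kernel is the annihilator $Y^\perp$ and which satisfies $\|z^*\|=\|Pz^*\|+\|z^*-Pz^*\|$ for all $z^*\in Z^*$. A Banach space $X$ is M-embedded if $X$ (canonically embedded) is an M-ideal in its bidual $X^{**}$. *)

theory Defs
  imports "HOL-Analysis.Analysis"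
begin

type_synonym 'a dual = "'a \<Rightarrow>\<^sub>L real"

lift_definition canonical_embedding :: "'a::real_normed_vector \<Rightarrow> 'a dual dual"
  is "\<lambda>x f. blinfun_apply f x"
  by (rule blinfun.bounded_linear_left)

definition annihilator :: "'z::real_normed_vector set \<Rightarrow> 'z dual set"
  where "annihilator Y = {f. \<forall>y\<in>Y. blinfun_apply f y = 0}"

(* Y need not be closed here. As "norm P = 1" is taken literally, {0} is not an M-ideal. *)
definition M_ideal :: "'z::banach set \<Rightarrow> bool"
  where "M_ideal Y \<longleftrightarrow> subspace Y \<and>
    (\<exists>P :: 'z dual \<Rightarrow>\<^sub>L 'z dual.
       P o\<^sub>L P = P \<and> norm P = 1 \<and>
       {f. blinfun_apply P f = 0} = annihilator Y \<and>
       (\<forall>f. norm f = norm (blinfun_apply P f) + norm (f - blinfun_apply P f)))"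

definition M_embedded :: "'a::banach itself \<Rightarrow> bool"
  where "M_embedded _ \<longleftrightarrow>
    M_ideal (range (canonical_embedding :: 'a \<Rightarrow> 'a dual dual))"

definition reflexive_space :: "'a::banach itself \<Rightarrow> bool"
  where "reflexive_space _ \<longleftrightarrow> surj (canonical_embedding :: 'a \<Rightarrow> 'a dual dual)"

definition almost_square :: "'a::banach itself \<Rightarrow> bool"
  where "almost_square _ \<longleftrightarrow>
    (\<forall>F \<subseteq> sphere (0::'a) 1. finite F \<longrightarrow>
      (\<exists>y :: nat \<Rightarrow> 'a.
         (\<forall>n. y n \<in> cball 0 1) \<and>
         (\<forall>x\<in>F. (\<lambda>n. norm (x + y n)) \<longlonglongrightarrow> 1 \<and> (\<lambda>n. norm (x - y n)) \<longlonglongrightarrow> 1) \<and>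
         (\<lambda>n. norm (y n)) \<longlonglongrightarrow> 1))"

end

theory Submission
  imports Defs "HOL-Library.Function_Algebras"
begin

text \<open>
  Take \<open>z\<close> in the unit sphere of the bidual almost at distance 1 from \<open>X\<close> (Riesz). The
  \<open>\<ell>\<^sub>1\<close>-decomposition of the third dual yields, by Hahn-Banach in a finite power of the bidual, some
  \<open>u \<in> X\<close> such that \<open>w = z - u\<close> satisfies \<open>\<parallel>x + w\<parallel> < 1 + \<epsilon>\<close> for all \<open>x\<close> in a given finite subset
  of the unit ball of \<open>X\<close>, while \<open>\<parallel>w\<parallel> \<ge> 1 - \<epsilon>\<close>. A second separation, now in a finite power of \<open>X\<close>,
  replaces \<open>w\<close> by an element of \<open>X\<close> that agrees with \<open>w\<close> on a functional almost norming \<open>w\<close>.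
\<close>

section \<open>Pointwise scalar multiplication on functions, which serve as powers of a
  space\<close>

instantiation "fun" :: (type, real_vector) real_vector
begin

definition "c *\<^sub>R f = (\<lambda>x. c *\<^sub>R f x)"

instance
  by standard (auto simp: scaleR_fun_def fun_eq_iff scaleR_add_left scaleR_add_right)

end

lemma scaleR_fun_apply [simp]: "(c *\<^sub>R f) x = c *\<^sub>R f x"
  by (simp add: scaleR_fun_def)

lemma sum_fun_apply: "(\<Sum>i\<in>I. f i) x = (\<Sum>i\<in>I. f i x)"
  by (induction I rule: infinite_finite_induct) auto

section \<open>The Mazur-Orlicz theorem\<close>

text \<open>The inequality for scalars gives equality: scale back by \<open>inverse c\<close> if
  \<open>c\<close> is positive, and use \<open>p 0 = 0\<close> otherwise.\<close>

definition sublinear :: "('a::real_vector \<Rightarrow> real) \<Rightarrow> bool"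
  where "sublinear p \<longleftrightarrow> (\<forall>x y. p (x + y) \<le> p x + p y) \<and> (\<forall>c\<ge>0. \<forall>x. p (c *\<^sub>R x) \<le> c * p x)"

lemma sublinearI:
  assumes "\<And>x y. p (x + y) \<le> p x + p y" "\<And>c x. 0 \<le> c \<Longrightarrow> p (c *\<^sub>R x) \<le> c * p x"
  shows "sublinear p"
  using assms unfolding sublinear_def by blast

lemma sublinear_add: "sublinear p \<Longrightarrow> p (x + y) \<le> p x + p y"
  unfolding sublinear_def by blast

lemma sublinear_scaleR: "sublinear p \<Longrightarrow> 0 \<le> c \<Longrightarrow> p (c *\<^sub>R x) \<le> c * p x"
  unfolding sublinear_def by blast

lemma sublinear_zero: "sublinear p \<Longrightarrow> p 0 = 0"
  using sublinear_add[of p 0 0] sublinear_scaleR[of p 0 0] by simp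

lemma sublinear_minus: "sublinear p \<Longrightarrow> - p (- x) \<le> p x"
  using sublinear_add[of p x "- x"] sublinear_zero[of p] by simp

text \<open>The minorant is the infimum of \<open>q (x + k) - c\<close> over the pairs
  \<open>(k, c)\<close> of the cone. The bound \<open>c \<le> q k\<close> keeps this infimum finite,
  since \<open>q k \<le> q (x + k) + q (- x)\<close>. A linear functional \<open>g\<close> below the
  minorant satisfies \<open>c \<le> g k\<close>, because \<open>g (- k) \<le> - c\<close>.\<close>

lemma sublinear_cone_minorant:
  assumes q: "sublinear q" and C: "convex_cone C"
    and le: "\<And>k c. (k, c) \<in> C \<Longrightarrow> c \<le> q k"
  obtains q' where "sublinear q'" "\<And>x. q' x \<le> q x" "\<And>k c. (k, c) \<in> C \<Longrightarrow> q' (- k) \<le> - c"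
proof -
  define h where "h x kc = q (x + fst kc) - snd kc" for x kc
  define q' where "q' x = (INF kc\<in>C. h x kc)" for x
  have C0: "(0, 0) \<in> C"
    using convex_cone_contains_0[OF C] by (simp add: zero_prod_def)
  have lower: "- q (- x) \<le> h x kc" if "kc \<in> C" for x kc
  proof -
    have "q (fst kc) \<le> q (x + fst kc) + q (- x)"
      using sublinear_add[OF q, of "x + fst kc" "- x"] by simp
    moreover have "snd kc \<le> q (fst kc)"
      using le[of "fst kc" "snd kc"] that by simp
    ultimately show ?thesis
      unfolding h_def by linarith
  qed
  then have bdd: "bdd_below (h x ` C)" for x
    by (intro bdd_belowI2)
  have upper: "q' x \<le> h x kc" if "kc \<in> C" for x kc
    unfolding q'_def by (rule cINF_lower[OF bdd that])
  have greatest: "b \<le> q' x" if "\<And>kc. kc \<in> C \<Longrightarrow> b \<le> h x kc" for b x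
    unfolding q'_def using C0 that by (intro cINF_greatest) auto
  have add: "q' (x + y) \<le> q' x + q' y" for x y
  proof -
    \<comment> \<open>The two infima are handled one after the other: first over \<open>k\<close>
      with \<open>l\<close> fixed, then over \<open>l\<close>.\<close>
    have "q' (x + y) - h y l \<le> q' x" if l: "l \<in> C" for l
    proof (rule greatest)
      fix k assume k: "k \<in> C"
      have "q' (x + y) \<le> h (x + y) (k + l)"
        using convex_cone_add[OF C k l] by (rule upper)
      also have "\<dots> \<le> h x k + h y l"
        using sublinear_add[OF q, of "x + fst k" "y + fst l"] by (simp add: h_def algebra_simps)
      finally show "q' (x + y) - h y l \<le> h x k"
        by simp
    qed
    then have "q' (x + y) - q' x \<le> q' y"
      by (intro greatest) (simp add: algebra_simps)
    then show ?thesis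
      by simp
  qed
  have scale_pos: "q' (c *\<^sub>R x) \<le> c * q' x" if "0 < c" for c x
  proof -
    have "q' (c *\<^sub>R x) / c \<le> q' x"
    proof (rule greatest)
      fix k assume k: "k \<in> C"
      have "q' (c *\<^sub>R x) \<le> h (c *\<^sub>R x) (c *\<^sub>R k)"
        using convex_cone_scaleR[OF C, of c k] k that by (intro upper) simp
      also have "\<dots> \<le> c * h x k"
        using sublinear_scaleR[OF q, of c "x + fst k"] that by (simp add: h_def algebra_simps)
      finally show "q' (c *\<^sub>R x) / c \<le> h x k"
        using that by (simp add: field_simps)
    qed
    then show ?thesis
      using that by (simp add: field_simps)
  qed
  have q'_le: "q' x \<le> q x" for x
    using upper[OF C0, of x] by (simp add: h_def)
  show thesis
  proof
    show "sublinear q'"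
    proof (rule sublinearI[OF add])
      fix c :: real and x
      assume "0 \<le> c"
      then show "q' (c *\<^sub>R x) \<le> c * q' x"
        using scale_pos[of c x] q'_le[of 0] sublinear_zero[OF q] by (cases "c = 0") auto
    qed
    show "q' (- k) \<le> - c" if "(k, c) \<in> C" for k c
      using upper[OF that, of "- k"] sublinear_zero[OF q] by (simp add: h_def)
  qed (rule q'_le)
qed

text \<open>Zorn's lemma for the reversed pointwise order. The infimum of a nonempty chain is
  bounded below by \<open>- q (- x)\<close>, and it is subadditive because any two members of the
  chain have a common lower bound in it.\<close>

lemma minimal_sublinear:
  assumes q: "sublinear q"
  obtains m where "sublinear m" "m \<le> q" "\<And>n. sublinear n \<Longrightarrow> n \<le> m \<Longrightarrow> n = m"
proof -
  define A where "A = {m. sublinear m \<and> m \<le> q}"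
  have "\<exists>m\<in>A. \<forall>a\<in>A. a \<le> m \<longrightarrow> a = m"
  proof (rule predicate_Zorn)
    show "partial_order_on A (relation_of (\<lambda>x y. y \<le> x) A)"
      by (rule partial_order_on_relation_ofI) auto
  next
    fix C assume C: "C \<in> Chains (relation_of (\<lambda>x y. y \<le> x) A)"
    have CA: "sublinear p" "p \<le> q" if "p \<in> C" for p
      using C that by (auto simp: Chains_def relation_of_def A_def)
    have chain: "a \<le> b \<or> b \<le> a" if "a \<in> C" "b \<in> C" for a b
      using C that by (auto simp: Chains_def relation_of_def)
    show "\<exists>u\<in>A. \<forall>a\<in>C. u \<le> a"
    proof (cases "C = {}")
      case True
      then show ?thesis
        using q by (auto simp: A_def)
    next
      case False
      define u where "u x = (INF p\<in>C. p x)" for x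
      have "- q (- x) \<le> p x" if "p \<in> C" for p x
        using sublinear_minus[OF CA(1)[OF that], of x] CA(2)[OF that] le_funD[of p q "- x"]
        by linarith
      then have bdd: "bdd_below ((\<lambda>p. p x) ` C)" for x
        by (intro bdd_belowI2)
      have upper: "u x \<le> p x" if "p \<in> C" for p x
        unfolding u_def by (rule cINF_lower[OF bdd that])
      have greatest: "b \<le> u x" if "\<And>p. p \<in> C \<Longrightarrow> b \<le> p x" for b x
        unfolding u_def using False that by (intro cINF_greatest) auto
      have add: "u (x + y) \<le> u x + u y" for x y
      proof -
        have "u (x + y) - r y \<le> u x" if r: "r \<in> C" for r
        proof (rule greatest)
          fix p assume p: "p \<in> C"
          obtain s where s: "s \<in> C" "s \<le> p" "s \<le> r"
            using chain[OF p r] p r by blast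
          have "u (x + y) \<le> s x + s y"
            using upper[OF s(1), of "x + y"] sublinear_add[OF CA(1)[OF s(1)], of x y] by linarith
          then show "u (x + y) - r y \<le> p x"
            using s(2,3) le_funD[of s p x] le_funD[of s r y] by linarith
        qed
        then have "u (x + y) - u x \<le> u y"
          by (intro greatest) (simp add: algebra_simps)
        then show ?thesis
          by simp
      qed
      have scale: "u (c *\<^sub>R x) \<le> c * u x" if "0 \<le> c" for c x
      proof (cases "c = 0")
        case True
        obtain p where "p \<in> C"
          using False by blast
        then show ?thesis
          using upper[of p 0] sublinear_zero[OF CA(1)[of p]] True by simp
      next
        case False
        then have "0 < c"
          using that by simp
        have "u (c *\<^sub>R x) / c \<le> u x"
        proof (rule greatest)
          fix p assume p: "p \<in> C"
          show "u (c *\<^sub>R x) / c \<le> p x"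
            using upper[OF p, of "c *\<^sub>R x"] sublinear_scaleR[OF CA(1)[OF p] that, of x] \<open>0 < c\<close>
            by (simp add: field_simps)
        qed
        then show ?thesis
          using \<open>0 < c\<close> by (simp add: field_simps)
      qed
      have "u \<le> q"
      proof (rule le_funI)
        fix x
        obtain p where "p \<in> C"
          using False by blast
        then show "u x \<le> q x"
          using upper[of p x] CA(2)[of p] le_funD[of p q x] by fastforce
      qed
      with sublinearI[of u, OF add scale] have "u \<in> A"
        by (simp add: A_def)
      then show ?thesis
        using upper by (auto simp: le_fun_def)
    qed
  qed
  then obtain m where m: "m \<in> A" "\<And>a. a \<in> A \<Longrightarrow> a \<le> m \<Longrightarrow> a = m"
    by blast
  show thesis
  proof
    show "n = m" if "sublinear n" "n \<le> m" for n
      using m that by (force simp: A_def)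
  qed (use m(1) in \<open>auto simp: A_def\<close>)
qed

text \<open>Oddness reverses every inequality: subadditivity at \<open>- x\<close>,
  \<open>- y\<close> gives superadditivity at \<open>x\<close>, \<open>y\<close>, and likewise for
  scalars.\<close>

lemma sublinear_odd_imp_linear:
  assumes m: "sublinear m" and odd: "\<And>y. m (- y) \<le> - m y"
  shows "linear m"
proof (rule linearI)
  have odd_eq: "m (- y) = - m y" for y
    using odd[of y] sublinear_minus[OF m, of y] by linarith
  show "m (x + y) = m x + m y" for x y
    using sublinear_add[OF m, of x y] sublinear_add[OF m, of "- x" "- y"] odd_eq[of "x + y"]
    by (simp add: odd_eq)
  have pos: "m (c *\<^sub>R x) = c * m x" if "0 \<le> c" for c x
    using sublinear_scaleR[OF m that, of x] sublinear_scaleR[OF m that, of "- x"]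
    by (simp add: odd_eq)
  show "m (c *\<^sub>R x) = c *\<^sub>R m x" for c x
  proof (cases "0 \<le> c")
    case False
    then have "m (- c *\<^sub>R x) = - c * m x"
      by (intro pos) simp
    then show ?thesis
      by (simp add: odd_eq)
  qed (simp add: pos)
qed

text \<open>This is the Hahn-Banach theorem for sublinear functionals: a minimal sublinear
  functional is odd, hence linear.\<close>

lemma linear_minorant:
  assumes q: "sublinear q"
  obtains g where "linear g" "g \<le> q"
proof -
  obtain m where m: "sublinear m" "m \<le> q" "\<And>n. sublinear n \<Longrightarrow> n \<le> m \<Longrightarrow> n = m"
    using minimal_sublinear[OF q] by metis
  \<comment> \<open>By minimality, the minorant of \<open>m\<close> attached to the ray through \<open>(y, m y)\<close> is \<open>m\<close> itself.\<close>
  have "m (- y) \<le> - m y" for y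
  proof -
    define C where "C = {(t *\<^sub>R y, t * m y) | t. 0 \<le> t}"
    have "convex_cone C"
      unfolding convex_cone_iff
    proof (intro conjI ballI allI impI)
      show "0 \<in> C"
        by (auto simp: C_def zero_prod_def intro!: exI[of _ 0])
    next
      fix a b assume "a \<in> C" "b \<in> C"
      then obtain s t where "a = (s *\<^sub>R y, s * m y)" "b = (t *\<^sub>R y, t * m y)" "0 \<le> s" "0 \<le> t"
        by (auto simp: C_def)
      then show "a + b \<in> C"
        by (auto simp: C_def algebra_simps intro!: exI[of _ "s + t"])
    next
      fix a and c :: real assume "a \<in> C" "0 \<le> c"
      then obtain s where "a = (s *\<^sub>R y, s * m y)" "0 \<le> s"
        by (auto simp: C_def)
      then show "c *\<^sub>R a \<in> C"
        using \<open>0 \<le> c\<close> by (auto simp: C_def intro!: exI[of _ "c * s"])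
    qed
    moreover have "c \<le> m k" if kc: "(k, c) \<in> C" for k c
    proof -
      obtain t where t: "k = t *\<^sub>R y" "c = t * m y" "0 \<le> t"
        using kc by (auto simp: C_def)
      show ?thesis
      proof (cases "t = 0")
        case False
        then show ?thesis
          using t sublinear_scaleR[OF m(1), of "inverse t" "t *\<^sub>R y"] by (simp add: field_simps)
      qed (use t sublinear_zero[OF m(1)] in simp)
    qed
    ultimately obtain n where n: "sublinear n" "\<And>x. n x \<le> m x" "\<And>k c. (k, c) \<in> C \<Longrightarrow> n (- k) \<le> - c"
      using sublinear_cone_minorant[OF m(1)] by metis
    have "n = m"
      using m(3) n(1,2) by (simp add: le_fun_def)
    moreover have "(y, m y) \<in> C"
      by (auto simp: C_def intro!: exI[of _ 1])
    ultimately show ?thesis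
      using n(3) by blast
  qed
  then have "linear m"
    by (rule sublinear_odd_imp_linear[OF m(1)])
  then show thesis
    using m(2) that by blast
qed

text \<open>A linear minorant of the functional from \<open>sublinear_cone_minorant\<close> meets
  both demands at once: it stays below \<open>q\<close>, and its values at \<open>- k\<close> give
  the lower bounds on the cone.\<close>

theorem mazur_orlicz:
  assumes "sublinear q" "convex_cone C" "\<And>k c. (k, c) \<in> C \<Longrightarrow> c \<le> q k"
  obtains g where "linear g" "\<And>x. g x \<le> q x" "\<And>k c. (k, c) \<in> C \<Longrightarrow> c \<le> g k"
proof -
  obtain q' where q': "sublinear q'" "\<And>x. q' x \<le> q x" "\<And>k c. (k, c) \<in> C \<Longrightarrow> q' (- k) \<le> - c"
    using sublinear_cone_minorant[OF assms] by metis
  obtain g where g: "linear g" "g \<le> q'"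
    using linear_minorant[OF q'(1)] by metis
  show thesis
  proof
    show "g x \<le> q x" for x
      using g(2) q'(2)[of x] by (auto simp: le_fun_def intro: order_trans)
    show "c \<le> g k" if "(k, c) \<in> C" for k c
    proof -
      have "g (- k) \<le> - c"
        using g(2) q'(3)[OF that] by (auto simp: le_fun_def intro: order_trans)
      then show ?thesis
        by (simp add: linear_neg[OF g(1)])
    qed
  qed (rule g(1))
qed

section \<open>Separation in finite powers of a normed space\<close>

lemma dual_almost_norming:
  fixes f :: "'a::real_normed_vector dual"
  assumes "0 < e"
  obtains x where "norm x \<le> 1" "norm f - e \<le> f x"
proof -
  have "\<exists>x. norm x \<le> 1 \<and> norm f - e \<le> f x"
  proof (rule ccontr)
    assume *: "\<not> ?thesis"
    then have less: "f x < norm f - e" if "norm x \<le> 1" for x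
      using that by fastforce
    \<comment> \<open>Positivity comes from the value at 0; it makes \<open>norm f - e\<close>
      admissible as a bound for the operator norm.\<close>
    have pos: "0 < norm f - e"
      using less[of 0] by simp
    have le: "f x \<le> (norm f - e) * norm x" for x
    proof (cases "x = 0")
      case False
      then have "f (inverse (norm x) *\<^sub>R x) < norm f - e"
        by (intro less) simp
      then show ?thesis
        using False by (simp add: blinfun.scaleR_right field_simps)
    qed simp
    have "norm f \<le> norm f - e"
    proof (rule norm_blinfun_bound)
      show "norm (f x) \<le> (norm f - e) * norm x" for x
        using le[of x] le[of "- x"] by (simp add: blinfun.minus_right abs_le_iff)
    qed (use pos in simp)
    then show False
      using assms by simp
  qed
  then show thesis
    using that by blast
qed

text \<open>The hypothesis \<open>far\<close> says that in the max norm the family \<open>a\<close>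
  has distance at least \<open>r\<close> from the constant families with value in \<open>Y\<close>.
  A functional separating them splits into coordinates \<open>f i\<close>, and the dual of the max
  norm is the sum of the norms.\<close>

lemma distance_to_subspace_dual:
  fixes a :: "'i \<Rightarrow> 'a::real_normed_vector"
  assumes fin: "finite I" and Y: "subspace Y"
    and far: "\<And>y. y \<in> Y \<Longrightarrow> \<exists>i\<in>I. r \<le> norm (a i - y)"
  obtains f :: "'i \<Rightarrow> 'a dual"
  where "\<And>y. y \<in> Y \<Longrightarrow> (\<Sum>i\<in>I. f i) y = 0" "(\<Sum>i\<in>I. norm (f i)) \<le> 1"
    "r \<le> (\<Sum>i\<in>I. f i (a i))"
proof -
  have ne: "I \<noteq> {}"
    using far[of 0] subspace_0[OF Y] by blast
  define p where "p u = (MAX i\<in>I. norm (u i))" for u :: "'i \<Rightarrow> 'a"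
  have p_le: "p u \<le> b \<longleftrightarrow> (\<forall>i\<in>I. norm (u i) \<le> b)" for u b
    unfolding p_def using fin ne by (simp add: Max_le_iff)
  have norm_le_p: "norm (u i) \<le> p u" if "i \<in> I" for u i
    using p_le[of u "p u"] that by simp
  have p_nonneg: "0 \<le> p u" for u
    using norm_le_p[of _ u] ne by (meson ex_in_conv norm_ge_zero order_trans)
  have p: "sublinear p"
  proof (rule sublinearI)
    show "p (u + v) \<le> p u + p v" for u v
      unfolding p_le by (auto intro!: norm_triangle_le add_mono norm_le_p)
    show "p (c *\<^sub>R u) \<le> c * p u" if "0 \<le> c" for c u
      unfolding p_le using that by (auto intro!: mult_left_mono norm_le_p)
  qed
  \<comment> \<open>On this cone, the lower bound forces a functional to vanish on the constant families from \<open>Y\<close>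
    (take \<open>t = 0\<close>) and to be at least \<open>r\<close> at \<open>a\<close>.\<close>
  define C where "C = {(t *\<^sub>R a - (\<lambda>i. y), t * r) | t y. 0 \<le> t \<and> y \<in> Y}"
  have CI: "(u, t * r) \<in> C" if "0 \<le> t" "y \<in> Y" "u = t *\<^sub>R a - (\<lambda>i. y)" for t y u
    using that unfolding C_def by blast
  have "convex_cone C"
    unfolding convex_cone_iff
  proof (intro conjI ballI allI impI)
    have "(0, 0 * r) \<in> C"
      using subspace_0[OF Y] by (intro CI[of 0 0]) (auto simp: fun_eq_iff)
    then show "0 \<in> C"
      by (simp add: zero_prod_def)
  next
    fix u v assume "u \<in> C" "v \<in> C"
    then obtain s y t y' where "0 \<le> s" "y \<in> Y" "0 \<le> t" "y' \<in> Y"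
      and uv: "u = (s *\<^sub>R a - (\<lambda>i. y), s * r)" "v = (t *\<^sub>R a - (\<lambda>i. y'), t * r)"
      unfolding C_def by blast
    then have "(s *\<^sub>R a - (\<lambda>i. y) + (t *\<^sub>R a - (\<lambda>i. y')), (s + t) * r) \<in> C"
      by (intro CI[of _ "y + y'"]) (auto simp: subspace_add[OF Y] fun_eq_iff algebra_simps)
    then show "u + v \<in> C"
      by (simp add: uv algebra_simps)
  next
    fix u and c :: real assume "u \<in> C" "0 \<le> c"
    then obtain s y where "0 \<le> s" "y \<in> Y" and u: "u = (s *\<^sub>R a - (\<lambda>i. y), s * r)"
      unfolding C_def by blast
    then have "(c *\<^sub>R (s *\<^sub>R a - (\<lambda>i. y)), (c * s) * r) \<in> C"
      using \<open>0 \<le> c\<close>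
      by (intro CI[of _ "c *\<^sub>R y"]) (auto simp: subspace_scale[OF Y] fun_eq_iff algebra_simps)
    then show "c *\<^sub>R u \<in> C"
      by (simp add: u mult.assoc)
  qed
  moreover have "c \<le> p u" if uc: "(u, c) \<in> C" for u c
  proof -
    obtain t y where t: "0 \<le> t" "y \<in> Y" "u = t *\<^sub>R a - (\<lambda>i. y)" "c = t * r"
      using uc unfolding C_def by blast
    show ?thesis
    proof (cases "t = 0")
      case False
      then have "0 < t"
        using t by simp
      obtain i where i: "i \<in> I" "r \<le> norm (a i - inverse t *\<^sub>R y)"
        using far[of "inverse t *\<^sub>R y"] t subspace_scale[OF Y] by blast
      have "u i = t *\<^sub>R (a i - inverse t *\<^sub>R y)"
        using False unfolding t(3) by (simp add: scaleR_diff_right)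
      then have "norm (u i) = t * norm (a i - inverse t *\<^sub>R y)"
        using \<open>0 < t\<close> by simp
      moreover have "t * r \<le> t * norm (a i - inverse t *\<^sub>R y)"
        using i(2) \<open>0 < t\<close> by simp
      ultimately show ?thesis
        using norm_le_p[OF i(1), of u] t(4) by linarith
    qed (use t p_nonneg in simp)
  qed
  ultimately obtain g where g: "linear g" "\<And>u. g u \<le> p u" "\<And>u c. (u, c) \<in> C \<Longrightarrow> c \<le> g u"
    using mazur_orlicz[OF p] by metis
  have abs_g: "\<bar>g u\<bar> \<le> p u" for u
  proof -
    have "p (- u) \<le> p u"
      unfolding p_le by (auto intro: norm_le_p)
    then show ?thesis
      using g(2)[of u] g(2)[of "- u"] by (simp add: linear_neg[OF g(1)] abs_le_iff)
  qed
  \<comment> \<open>The coordinate embeddings, through which \<open>g\<close> is decomposed.\<close>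
  define d where "d i x = (\<lambda>j. if j = i then x else 0)" for i :: 'i and x :: 'a
  have d_lin: "linear (d i)" for i
    by (rule linearI) (auto simp: d_def fun_eq_iff)
  have "bounded_linear (\<lambda>x. g (d i x))" for i
  proof (rule bounded_linear_intro[of _ 1])
    show "g (d i (x + y)) = g (d i x) + g (d i y)" for x y
      by (simp add: linear_add[OF d_lin] linear_add[OF g(1)])
    show "g (d i (c *\<^sub>R x)) = c *\<^sub>R g (d i x)" for c x
      by (simp add: linear_scale[OF d_lin] linear_scale[OF g(1)])
    have "p (d i x) \<le> norm x" for x
      unfolding p_le by (simp add: d_def)
    then show "norm (g (d i x)) \<le> norm x * 1" for x
      using abs_g[of "d i x"] order_trans by fastforce
  qed
  then have f: "blinfun_apply (Blinfun (\<lambda>x. g (d i x))) x = g (d i x)" for i x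
    by (simp add: bounded_linear_Blinfun_apply)
  define f where "f i = Blinfun (\<lambda>x. g (d i x))" for i
  have g_eq: "g u = (\<Sum>i\<in>I. f i (u i))" for u
  proof -
    \<comment> \<open>Outside \<open>I\<close> the family \<open>w\<close> may be nonzero, but
      \<open>p\<close> sees only the indices in \<open>I\<close>, so \<open>g\<close> vanishes at
      \<open>w\<close>.\<close>
    define w where "w = u - (\<Sum>i\<in>I. d i (u i))"
    have "w j = 0" if "j \<in> I" for j
      using fin that by (simp add: w_def sum_fun_apply d_def)
    then have "p w \<le> 0"
      by (simp add: p_le)
    then have "g w = 0"
      using abs_g[of w] by simp
    then show ?thesis
      by (simp add: w_def linear_diff[OF g(1)] linear_sum[OF g(1)] f_def f)
  qed
  show thesis
  proof
    fix y assume "y \<in> Y"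
    then have "(t *\<^sub>R (\<lambda>i. y), 0 * r) \<in> C" for t :: real
      by (intro CI[of 0 "- t *\<^sub>R y"]) (auto simp: subspace_neg[OF Y] subspace_scale[OF Y] fun_eq_iff)
    from g(3)[OF this[of 1]] g(3)[OF this[of "- 1"]] have "g (\<lambda>i. y) = 0"
      by (simp add: linear_neg[OF g(1)])
    then show "(\<Sum>i\<in>I. f i) y = 0"
      by (simp add: g_eq blinfun.sum_left)
  next
    have "(a, 1 * r) \<in> C"
      using subspace_0[OF Y] by (intro CI[of 1 0]) (auto simp: fun_eq_iff)
    then show "r \<le> (\<Sum>i\<in>I. f i (a i))"
      using g(3)[of a r] by (simp add: g_eq)
  next
    show "(\<Sum>i\<in>I. norm (f i)) \<le> 1"
    proof (rule field_le_epsilon)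
      fix e :: real assume "0 < e"
      \<comment> \<open>Each coordinate may lose \<open>e'\<close>, so that the total loss over
        \<open>I\<close> is \<open>e\<close>.\<close>
      define e' where "e' = e / card I"
      have card: "0 < card I"
        using fin ne by (simp add: card_gt_0_iff)
      then have "0 < e'"
        using \<open>0 < e\<close> by (simp add: e'_def)
      then have "\<exists>x. norm x \<le> 1 \<and> norm (f i) - e' \<le> f i x" for i
        using dual_almost_norming[of e' "f i"] by metis
      then obtain x where x: "\<And>i. norm (x i) \<le> 1" "\<And>i. norm (f i) - e' \<le> f i (x i)"
        by metis
      have "(\<Sum>i\<in>I. norm (f i)) - e = (\<Sum>i\<in>I. norm (f i) - e')"
        using card by (simp add: sum_subtractf e'_def)
      also have "\<dots> \<le> g x"
        unfolding g_eq by (intro sum_mono x)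
      also have "\<dots> \<le> p x"
        by (rule g)
      also have "\<dots> \<le> 1"
        using x(1) by (simp add: p_le)
      finally show "(\<Sum>i\<in>I. norm (f i)) \<le> 1 + e"
        by simp
    qed
  qed
qed

section \<open>The canonical embedding\<close>

lemma canonical_embedding_apply [simp]: "canonical_embedding x f = f x"
  by transfer simp

lemma linear_canonical_embedding: "linear canonical_embedding"
  by (rule linearI) (auto intro!: blinfun_eqI simp: blinfun.bilinear_simps)

lemma norm_canonical_embedding [simp]: "norm (canonical_embedding x) = norm x"
proof (rule antisym)
  show "norm (canonical_embedding x) \<le> norm x"
  proof (rule norm_blinfun_bound)
    show "norm (canonical_embedding x f) \<le> norm x * norm f" for f
      using norm_blinfun[of f x] by (simp add: mult.commute)
  qed simp
  \<comment> \<open>With a one-point index set and the zero subspace, the separation lemma yields a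
    norming functional.\<close>
  obtain f :: "unit \<Rightarrow> 'a dual" where f: "norm (f ()) \<le> 1" "norm x \<le> f () x"
    using distance_to_subspace_dual[of "{()}" "{0}" "norm x" "\<lambda>_. x"]
    by (auto simp: subspace_0)
  have "norm x \<le> norm (canonical_embedding x (f ()))"
    using f(2) by simp
  also have "\<dots> \<le> norm (canonical_embedding x) * norm (f ())"
    by (rule norm_blinfun)
  also have "\<dots> \<le> norm (canonical_embedding x)"
    using f(1) by (simp add: mult_left_le)
  finally show "norm x \<le> norm (canonical_embedding x)" .
qed

lemma subspace_range_canonical_embedding: "subspace (range canonical_embedding)"
  using linear_subspace_image[OF linear_canonical_embedding subspace_UNIV] .

text \<open>An isometric image of a complete space is complete, hence closed; Riesz's lemma will use
  this.\<close>

lemma closed_range_canonical_embedding: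
  "closed (range (canonical_embedding :: 'a::banach \<Rightarrow> 'a dual dual))"
proof -
  have "bounded_linear (canonical_embedding :: 'a \<Rightarrow> 'a dual dual)"
    by (intro bounded_linear_intro[of _ 1])
      (simp_all add: linear_add[OF linear_canonical_embedding] linear_scale[OF linear_canonical_embedding])
  then have "complete (range (canonical_embedding :: 'a \<Rightarrow> 'a dual dual))"
    by (intro complete_isometric_image[of 1 UNIV]) (auto simp: complete_UNIV subspace_UNIV)
  then show ?thesis
    by (rule complete_imp_closed)
qed

lemma dual_eq_scaleR_if_kernel_subset:
  fixes f g :: "'a::real_normed_vector dual"
  assumes "\<And>x. g x = 0 \<Longrightarrow> f x = 0"
  obtains c where "f = c *\<^sub>R g"
proof (cases "g = 0")
  case True
  then have "f = 0"
    using assms by (intro blinfun_eqI) simp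
  then show ?thesis
    using that[of 0] by simp
next
  case False
  then obtain v where v: "g v \<noteq> 0"
    by (metis blinfun_eqI blinfun.zero_left)
  have "f = (f v / g v) *\<^sub>R g"
  proof (rule blinfun_eqI)
    fix x
    \<comment> \<open>Subtracting this multiple of \<open>v\<close> moves \<open>x\<close> into the
      kernel of \<open>g\<close>.\<close>
    have "g (x - (g x / g v) *\<^sub>R v) = 0"
      using v by (simp add: blinfun.bilinear_simps)
    then have "f (x - (g x / g v) *\<^sub>R v) = 0"
      by (rule assms)
    then show "f x = ((f v / g v) *\<^sub>R g) x"
      by (simp add: blinfun.bilinear_simps)
  qed
  then show ?thesis
    by (rule that)
qed

text \<open>A Helly-type substitute for the principle of local reflexivity.\<close>

lemma bidual_lifting:
  fixes A :: "'a::real_normed_vector set" and w :: "'a dual dual" and g :: "'a dual"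
  assumes fin: "finite A" and w: "\<And>x. x \<in> A \<Longrightarrow> norm (canonical_embedding x + w) \<le> s"
    and "s < r" "0 \<le> s"
  obtains y where "g y = w g" "\<And>x. x \<in> A \<Longrightarrow> norm (x + y) < r"
proof -
  obtain y0 where y0: "g y0 = w g"
  proof (cases "g = 0")
    case False
    then obtain v where "g v \<noteq> 0"
      by (metis blinfun_eqI blinfun.zero_left)
    then show ?thesis
      using that[of "(w g / g v) *\<^sub>R v"] by (simp add: blinfun.scaleR_right)
  qed (use that[of 0] in simp)
  \<comment> \<open>Corrections of \<open>y0\<close> from this kernel leave the prescribed value at
    \<open>g\<close> unchanged.\<close>
  define Y where "Y = {v. g v = 0}"
  have Y: "subspace Y"
    by (auto simp: Y_def subspace_def blinfun.bilinear_simps)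
  have "\<exists>v\<in>Y. \<forall>x\<in>A. norm (x + y0 - v) < r"
  proof (rule ccontr)
    assume "\<not> ?thesis"
    then have far: "\<exists>x\<in>A. r \<le> norm (x + y0 - v)" if "v \<in> Y" for v
      using that by (meson not_le)
    obtain f :: "'a \<Rightarrow> 'a dual" where f: "\<And>y. y \<in> Y \<Longrightarrow> (\<Sum>x\<in>A. f x) y = 0"
      "(\<Sum>x\<in>A. norm (f x)) \<le> 1" "r \<le> (\<Sum>x\<in>A. f x (x + y0))"
      by (rule distance_to_subspace_dual[OF fin Y far]) (assumption, rule that)
    \<comment> \<open>The sum vanishes on the kernel of \<open>g\<close>, so it is a multiple of
      \<open>g\<close>, on which \<open>y0\<close> and \<open>w\<close> agree. This lets
      \<open>w\<close> replace \<open>y0\<close> in the sum below.\<close>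
    obtain c where c: "(\<Sum>x\<in>A. f x) = c *\<^sub>R g"
      using dual_eq_scaleR_if_kernel_subset[of g "\<Sum>x\<in>A. f x"] f(1) by (auto simp: Y_def)
    have "(\<Sum>x\<in>A. f x y0) = (\<Sum>x\<in>A. f x) y0"
      by (simp add: blinfun.sum_left)
    also have "\<dots> = w (\<Sum>x\<in>A. f x)"
      by (simp add: c y0 blinfun.scaleR_left blinfun.scaleR_right)
    finally have "(\<Sum>x\<in>A. f x (x + y0)) = (\<Sum>x\<in>A. (canonical_embedding x + w) (f x))"
      by (simp add: blinfun.bilinear_simps blinfun.sum_right sum.distrib)
    also have "\<dots> \<le> (\<Sum>x\<in>A. s * norm (f x))"
    proof (rule sum_mono)
      fix x assume "x \<in> A"
      have "(canonical_embedding x + w) (f x) \<le> norm (canonical_embedding x + w) * norm (f x)"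
        using norm_blinfun[of "canonical_embedding x + w" "f x"] by simp
      also have "\<dots> \<le> s * norm (f x)"
        by (intro mult_right_mono w \<open>x \<in> A\<close>) simp
      finally show "(canonical_embedding x + w) (f x) \<le> s * norm (f x)" .
    qed
    also have "\<dots> \<le> s"
      using f(2) \<open>0 \<le> s\<close> by (simp add: sum_distrib_left[symmetric] mult_left_le)
    finally show False
      using f(3) \<open>s < r\<close> by simp
  qed
  then obtain v where "g v = 0" "\<And>x. x \<in> A \<Longrightarrow> norm (x + y0 - v) < r"
    by (auto simp: Y_def)
  then show thesis
    using that[of "y0 - v"] y0 by (simp add: blinfun.diff_right add_diff_eq)
qed

section \<open>M-ideals\<close>

text \<open>This is a ball intersection property of M-ideals, proved by contradiction: if the balls
  around the points \<open>z + x\<close> had no common point in \<open>Y\<close>, there would be a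
  separating family whose sum annihilates \<open>Y\<close>, and the l1-splitting bounds its total
  value by 1.\<close>

lemma M_ideal_ball_intersection:
  fixes Y :: "'z::banach set"
  assumes M: "M_ideal Y" and A: "finite A" "A \<subseteq> Y" "\<And>x. x \<in> A \<Longrightarrow> norm x \<le> 1"
    and z: "norm z \<le> 1" and "0 < e"
  obtains u where "u \<in> Y" "\<And>x. x \<in> A \<Longrightarrow> norm (z + x - u) < 1 + e"
proof -
  have Y: "subspace Y"
    using M by (simp add: M_ideal_def)
  obtain P :: "'z dual \<Rightarrow>\<^sub>L 'z dual" where idem: "P o\<^sub>L P = P"
    and ker: "{f. P f = 0} = annihilator Y"
    and split: "\<And>f. norm f = norm (P f) + norm (f - P f)"
    using M unfolding M_ideal_def by blast
  have "\<exists>u\<in>Y. \<forall>x\<in>A. norm (z + x - u) < 1 + e"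
  proof (rule ccontr)
    assume "\<not> ?thesis"
    then have far: "\<exists>x\<in>A. 1 + e \<le> norm (z + x - u)" if "u \<in> Y" for u
      using that by (meson not_le)
    obtain f :: "'z \<Rightarrow> 'z dual" where f: "\<And>y. y \<in> Y \<Longrightarrow> (\<Sum>x\<in>A. f x) y = 0"
      "(\<Sum>x\<in>A. norm (f x)) \<le> 1" "1 + e \<le> (\<Sum>x\<in>A. f x (z + x))"
      by (rule distance_to_subspace_dual[OF A(1) Y far]) (assumption, rule that)
    have "(\<Sum>x\<in>A. f x) \<in> annihilator Y"
      using f(1) by (simp add: annihilator_def)
    then have "P (\<Sum>x\<in>A. f x) = 0"
      using ker by blast
    then have sum0: "(\<Sum>x\<in>A. P (f x) z) = 0"
      by (metis blinfun.sum_right blinfun.sum_left blinfun.zero_left)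
    have on_Y: "f x x = P (f x) x" if "x \<in> A" for x
    proof -
      have "P (P (f x)) = P (f x)"
        by (metis idem blinfun_apply_blinfun_compose)
      then have "P (f x - P (f x)) = 0"
        by (simp add: blinfun.diff_right)
      then have "f x - P (f x) \<in> annihilator Y"
        using ker by blast
      then show ?thesis
        using that A(2) by (auto simp: annihilator_def blinfun.diff_left)
    qed
    have bound: "h x \<le> norm h" if "norm x \<le> 1" for h :: "'z dual" and x
      using norm_blinfun[of h x] mult_left_le[OF that norm_ge_zero[of h]] by simp
    \<comment> \<open>At \<open>z\<close> the parts \<open>P (f x)\<close> cancel in total, and at
      \<open>x\<close> in \<open>Y\<close> only they contribute. Each of the two parts of
      \<open>f x\<close> is thus evaluated at a single vector of the unit ball.\<close>
    have "(\<Sum>x\<in>A. f x (z + x)) = (\<Sum>x\<in>A. P (f x) x + (f x - P (f x)) z)"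
      using sum0 by (simp add: blinfun.bilinear_simps sum.distrib sum_subtractf on_Y)
    also have "\<dots> \<le> (\<Sum>x\<in>A. norm (f x))"
      unfolding split[of "f _"] by (intro sum_mono add_mono bound A z)
    finally show False
      using f(2,3) \<open>0 < e\<close> by simp
  qed
  then show thesis
    using that by blast
qed

text \<open>Choose \<open>y0\<close> in \<open>Y\<close> whose distance from \<open>z0\<close>
  exceeds the infimum by a factor less than \<open>1 / (1 - e)\<close>, and normalise
  \<open>z0 - y0\<close>. A closer \<open>y\<close> would make \<open>y0 + n *\<^sub>R y\<close> too
  close to \<open>z0\<close>.\<close>

lemma riesz_lemma:
  fixes Y :: "'z::real_normed_vector set"
  assumes Y: "subspace Y" "closed Y" "Y \<noteq> UNIV" and e: "0 < e" "e < 1"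
  obtains z where "norm z = 1" "\<And>y. y \<in> Y \<Longrightarrow> 1 - e \<le> norm (z - y)"
proof -
  obtain z0 where z0: "z0 \<notin> Y"
    using Y(3) by blast
  have ne: "Y \<noteq> {}"
    using subspace_0[OF Y(1)] by blast
  have pos: "0 < infdist z0 Y"
    using in_closed_iff_infdist_zero[OF Y(2) ne, of z0] z0 infdist_nonneg[of z0 Y]
    by (simp add: less_le)
  then have "infdist z0 Y < infdist z0 Y / (1 - e)"
    using e by (simp add: field_simps)
  then obtain y0 where y0: "y0 \<in> Y" "dist z0 y0 < infdist z0 Y / (1 - e)"
    using ne cINF_less_iff[of Y "dist z0"] by (auto simp: infdist_notempty)
  define n where "n = norm (z0 - y0)"
  have n: "0 < n"
    using z0 y0(1) by (auto simp: n_def)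
  have near: "n * (1 - e) < infdist z0 Y"
    using y0(2) e by (simp add: n_def dist_norm field_simps)
  show thesis
  proof
    show "norm (inverse n *\<^sub>R (z0 - y0)) = 1"
      using n by (simp add: n_def)
    fix y assume y: "y \<in> Y"
    have "infdist z0 Y \<le> dist z0 (y0 + n *\<^sub>R y)"
      using y y0(1) by (intro infdist_le subspace_add[OF Y(1)] subspace_scale[OF Y(1)])
    also have "\<dots> = norm (n *\<^sub>R (inverse n *\<^sub>R (z0 - y0) - y))"
      using n by (simp add: dist_norm scaleR_diff_right algebra_simps)
    also have "\<dots> = n * norm (inverse n *\<^sub>R (z0 - y0) - y)"
      using n by simp
    finally have "n * (1 - e) \<le> n * norm (inverse n *\<^sub>R (z0 - y0) - y)"
      using near by simp
    then show "1 - e \<le> norm (inverse n *\<^sub>R (z0 - y0) - y)"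
      using n by simp
  qed
qed

section \<open>Almost squareness of non-reflexive M-embedded spaces\<close>

lemma M_embedded_almost_square_step:
  fixes F :: "'a::banach set"
  assumes "\<not> reflexive_space TYPE('a)" "M_embedded TYPE('a)"
    and F: "finite F" "F \<subseteq> sphere 0 1" and e: "0 < e" "e < 1"
  obtains y where "norm y \<le> 1" "1 - e \<le> norm y"
    "\<And>x. x \<in> F \<Longrightarrow> \<bar>norm (x + y) - 1\<bar> \<le> e \<and> \<bar>norm (x - y) - 1\<bar> \<le> e"
proof -
  let ?J = "canonical_embedding :: 'a \<Rightarrow> 'a dual dual"
  note lin = linear_canonical_embedding[where ?'a = 'a]
  \<comment> \<open>The error budget: Riesz's lemma and the choice of \<open>g\<close> cost
    \<open>d\<close> each in the lower bound, the intersection and the lifting together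
    \<open>2 * d\<close> in the upper bound, and the final rescaling another \<open>2 * d\<close> in
    either.\<close>
  define d where "d = e / 4"
  have d: "0 < d" "d < 1" "e = 4 * d"
    using e by (auto simp: d_def)
  \<comment> \<open>0 controls \<open>\<parallel>y\<parallel>\<close>, the negatives control \<open>\<parallel>x - y\<parallel>\<close>.\<close>
  define A where "A = insert 0 (F \<union> uminus ` F)"
  have A: "finite A" "\<And>x. x \<in> A \<Longrightarrow> norm x \<le> 1"
    using F by (auto simp: A_def)
  have proper: "range ?J \<noteq> UNIV"
    using assms(1) by (simp add: reflexive_space_def)
  obtain z where z: "norm z = 1" "\<And>y. y \<in> range ?J \<Longrightarrow> 1 - d \<le> norm (z - y)"
    using riesz_lemma[OF subspace_range_canonical_embedding closed_range_canonical_embedding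
        proper d(1,2)] by metis
  have "M_ideal (range ?J)"
    using assms(2) by (simp add: M_embedded_def)
  moreover have "finite (?J ` A)" "?J ` A \<subseteq> range ?J" "\<And>x. x \<in> ?J ` A \<Longrightarrow> norm x \<le> 1"
    using A by auto
  ultimately obtain u where u: "u \<in> range ?J" "\<And>x. x \<in> ?J ` A \<Longrightarrow> norm (z + x - u) < 1 + d"
    using M_ideal_ball_intersection[of "range ?J" "?J ` A" z d] z(1) d(1) by auto
  define w where "w = z - u"
  have w: "1 - d \<le> norm w" "\<And>x. x \<in> A \<Longrightarrow> norm (?J x + w) \<le> 1 + d"
    using z(2)[OF u(1)] u(2) by (force simp: w_def algebra_simps)+
  \<comment> \<open>Preserving the value at this single functional is enough to keep the lifted
    \<open>y\<close> large in norm.\<close>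
  obtain g where g: "norm g \<le> 1" "norm w - d \<le> w g"
    using dual_almost_norming[OF d(1), of w] by metis
  obtain y where y: "g y = w g" "\<And>x. x \<in> A \<Longrightarrow> norm (x + y) < 1 + 2 * d"
    using bidual_lifting[OF A(1) w(2), of "1 + 2 * d" g] d(1) by auto
  have "1 - 2 * d \<le> g y"
    using g(2) w(1) y(1) by simp
  also have "\<dots> \<le> norm g * norm y"
    using norm_blinfun[of g y] by simp
  also have "\<dots> \<le> norm y"
    using g(1) mult_right_mono[of "norm g" 1 "norm y"] by simp
  finally have y_lower: "1 - 2 * d \<le> norm y" .
  have y_upper: "norm y < 1 + 2 * d"
    using y(2)[of 0] by (simp add: A_def)
  \<comment> \<open>Rescaling brings \<open>y\<close> into the unit ball and moves it by at most
    \<open>2 * d\<close>.\<close>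
  define y' where "y' = inverse (1 + 2 * d) *\<^sub>R y"
  have y_eq: "y = (1 + 2 * d) *\<^sub>R y'"
    using d(1) by (simp add: y'_def)
  have norm_y: "norm y = (1 + 2 * d) * norm y'"
    using d(1) by (simp add: y_eq)
  have upper: "norm y' \<le> 1"
    using y_upper d(1) by (simp add: norm_y)
  have small: "2 * d * norm y' \<le> 2 * d"
    using upper d(1) by simp
  have "norm y = norm y' + 2 * d * norm y'"
    by (simp add: norm_y algebra_simps)
  then have lower: "1 - e \<le> norm y'"
    using y_lower small d(3) by linarith
  have "y - y' = (2 * d) *\<^sub>R y'"
    by (simp add: y_eq algebra_simps)
  then have near: "norm (y - y') \<le> 2 * d"
    using small d(1) by simp
  have le: "norm (x + y') \<le> 1 + e" if "x \<in> A" for x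
  proof -
    have "norm (x + y') \<le> norm (x + y) + norm (y - y')"
      using norm_triangle_ineq4[of "x + y" "y - y'"] by simp
    then show ?thesis
      using y(2)[OF that] near d(3) by simp
  qed
  have "\<bar>norm (x + y') - 1\<bar> \<le> e \<and> \<bar>norm (x - y') - 1\<bar> \<le> e" if x: "x \<in> F" for x
  proof -
    have plus: "norm (x + y') \<le> 1 + e" and minus: "norm (x - y') \<le> 1 + e"
      using le[of x] le[of "- x"] x norm_minus_cancel[of "x - y'"] by (auto simp: A_def)
    \<comment> \<open>The sum is twice the unit vector \<open>x\<close>, so the upper bound for one
      sign forces the lower bound for the other.\<close>
    have "2 = norm ((x + y') + (x - y'))"
      using x F(2) by (auto simp flip: scaleR_2)
    also have "\<dots> \<le> norm (x + y') + norm (x - y')"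
      by (rule norm_triangle_ineq)
    finally show ?thesis
      using plus minus by linarith
  qed
  then show thesis
    using that[of y'] upper lower by blast
qed

theorem corollary4p3:
  assumes "\<not> reflexive_space TYPE('a::banach)"
    and "M_embedded TYPE('a)"
  shows "almost_square TYPE('a)"
  unfolding almost_square_def
proof (intro allI impI)
  fix F :: "'a set"
  assume F: "F \<subseteq> sphere 0 1" "finite F"
  \<comment> \<open>The double successor makes \<open>e n < 1\<close> hold already at
    \<open>n = 0\<close>.\<close>
  define e where "e n = inverse (real (Suc (Suc n)))" for n
  have e: "0 < e n" "e n < 1" for n
    by (auto simp: e_def field_simps)
  have e_lim: "e \<longlonglongrightarrow> 0"
    unfolding e_def by (rule LIMSEQ_Suc[OF LIMSEQ_inverse_real_of_nat])
  have "\<exists>y. norm y \<le> 1 \<and> 1 - e n \<le> norm y \<and>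
      (\<forall>x\<in>F. \<bar>norm (x + y) - 1\<bar> \<le> e n \<and> \<bar>norm (x - y) - 1\<bar> \<le> e n)" for n
    using M_embedded_almost_square_step[OF assms F(2,1) e[of n]] by metis
  then obtain y where y: "\<And>n. norm (y n) \<le> 1" "\<And>n. 1 - e n \<le> norm (y n)"
    "\<And>n x. x \<in> F \<Longrightarrow> \<bar>norm (x + y n) - 1\<bar> \<le> e n"
    "\<And>n x. x \<in> F \<Longrightarrow> \<bar>norm (x - y n) - 1\<bar> \<le> e n"
    by metis
  have lim: "h \<longlonglongrightarrow> 1" if "\<And>n. \<bar>h n - 1\<bar> \<le> e n" for h
    by (rule LIM_zero_cancel, rule Lim_null_comparison[OF _ e_lim]) (simp add: that)
  have "\<bar>norm (y n) - 1\<bar> \<le> e n" for n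
    using y(1,2)[of n] by linarith
  then show "\<exists>y. (\<forall>n. y n \<in> cball 0 1) \<and>
      (\<forall>x\<in>F. (\<lambda>n. norm (x + y n)) \<longlonglongrightarrow> 1 \<and> (\<lambda>n. norm (x - y n)) \<longlonglongrightarrow> 1) \<and>
      (\<lambda>n. norm (y n)) \<longlonglongrightarrow> 1"
    using y by (intro exI[of _ y]) (auto intro!: lim)
qed

end
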